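(* The solution to the system $$u''=uv^2,\qquad v''=vu^2,\qquad u>0,\ v>0\qquad\text{in }\mathbb{R}$$ is unique, up to translations and scaling.
   Context: The unknowns $u,v$ are positive functions of one real variable, defined on the whole of $\mathbb{R}$. The system is invariant under the translations $(u(x),v(x))\mapsto(u(x+t),v(x+t))$ for all $t\in\mathbb{R}$, and under the scalings $(u(x),v(x))\mapsto(\lambda u(\lambda x),\lambda v(\lambda x))$ for all $\lambda>0$; these are the translations and scalings meant in the claim.
   Formalization: Uniqueness is up to translations, scalings and interchange of u and v: if (u,v) is a solution so is (v,u), and the two are never related by translations and scalings, since exactly one component is increasing and these operations preserve which one. *)

theory Defs
  imports Complex_Main
begin

text \<open>Classical solutions on the whole line. Only two-fold differentiability is demanded;
  continuity of the second derivatives is then automatic from the equations.\<close>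

definition entire_solution :: "(real \<Rightarrow> real) \<Rightarrow> (real \<Rightarrow> real) \<Rightarrow> bool" where
  "entire_solution u v \<longleftrightarrow>
     (\<forall>x. u x > 0 \<and> v x > 0) \<and>
     (\<exists>u' v'. \<forall>x.
        (u has_real_derivative u' x) (at x) \<and>
        (v has_real_derivative v' x) (at x) \<and>
        (u' has_real_derivative u x * (v x)\<^sup>2) (at x) \<and>
        (v' has_real_derivative v x * (u x)\<^sup>2) (at x))"

definition translation :: "real \<Rightarrow> (real \<Rightarrow> real) \<Rightarrow> real \<Rightarrow> real" where
  "translation t f = (\<lambda>x. f (x + t))"

definition scaling :: "real \<Rightarrow> (real \<Rightarrow> real) \<Rightarrow> real \<Rightarrow> real" where
  "scaling l f = (\<lambda>x. l * f (l * x))"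

text \<open>Since a translation by \<open>s\<close> after a scaling by \<open>l\<close> is the scaling by \<open>l\<close> after the translation
  by \<open>l * s\<close>, every composition of translations and scalings has the form used here, so this is
  the orbit relation of the group they generate.

  The system is also invariant under interchanging \<open>u\<close> and \<open>v\<close>, and no solution is related to its
  interchange: in a solution one component is increasing and the other decreasing, and
  translations and scalings preserve this. Uniqueness of the ordered pair would thus be false; it
  holds for the pair up to the labelling of its components.\<close>

definition equal_up_to_translation_scaling ::
    "(real \<Rightarrow> real) \<times> (real \<Rightarrow> real) \<Rightarrow> (real \<Rightarrow> real) \<times> (real \<Rightarrow> real) \<Rightarrow> bool" where
  "equal_up_to_translation_scaling p q \<longleftrightarrow>
     (\<exists>t l. l > 0 \<and>
        fst q = scaling l (translation t (fst p)) \<and>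
        snd q = scaling l (translation t (snd p)))"

end

theory Submission
  imports Defs
begin

text \<open>
  Along a solution, \<open>u'\<^sup>2 + v'\<^sup>2 - u\<^sup>2 v\<^sup>2\<close> is constant. The derivatives \<open>u'\<close> and \<open>v'\<close> never have
  the same weak sign, for otherwise \<open>w = u v\<close> would satisfy \<open>w'' \<ge> 2 w\<^sup>2\<close> and blow up in finite time
  (\<open>no_global_superquadratic\<close>). So, after exchanging the names if necessary, \<open>u\<close> increases and
  \<open>v\<close> decreases. Then \<open>u v \<le> u'\<close> and \<open>u v \<le> - v'\<close>; in particular the conserved quantity is positive,
  and a scaling makes it equal to 1.

  The trajectory \<open>(u, v)\<close> is now a geodesic of the Jacobi metric \<open>(1 + u\<^sup>2 v\<^sup>2) (du\<^sup>2 + dv\<^sup>2)\<close>, whose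
  curvature has the sign of \<open>u\<^sup>2 v\<^sup>2 - 1\<close>, and the two estimates above keep it inside the region
  \<open>u v \<le> 1\<close> of nonpositive curvature. It is the graph \<open>v = f(u)\<close> of a function on the half line
  \<open>u > 0\<close> that is asymptotic to both axes, and passing to the graph removes the translations.
  Two different graphs would enclose a region of negative curvature bounded by two geodesics that
  meet, possibly at infinity, at both ends, which contradicts the theorem of Gauss and Bonnet.

  The last step is carried out with an explicit form of that theorem. Put
  \<open>\<phi> = ln (1 + u\<^sup>2 v\<^sup>2) / 2\<close>. The angle \<open>arctan f'\<close> of a geodesic graph, corrected by the integral of
  \<open>\<partial>\<phi>/\<partial>u\<close> over the vertical segment from the axis to the graph, has a derivative \<open>\<kappa> s (f s)\<close> that
  depends on the position only, and \<open>\<partial>\<kappa>/\<partial>v = \<Delta>\<phi> \<ge> 0\<close>. Hence the difference of the corrected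
  angles of two graphs increases strictly where the first lies above the second; but it is
  nonnegative at the left end and nonpositive at the right end of every interval on which this
  happens (\<open>phase_curve_le\<close>). The graph and the conserved quantity determine the velocity, so two
  normalised solutions with the same graph differ by a translation.
\<close>

section \<open>Finite time blow-up\<close>

text \<open>The energy \<open>w'\<^sup>2 - 4/3 w\<^sup>3\<close> is nondecreasing, so \<open>w'\<^sup>2 \<ge> w\<^sup>3\<close> once \<open>w\<close> is large. From then on
  \<open>1 / sqrt w\<close> decreases at least at the rate 1/2, and would have to become negative.\<close>

lemma no_global_superquadratic:
  fixes w w' w'' :: "real \<Rightarrow> real"
  assumes Dw: "\<And>x. (w has_real_derivative w' x) (at x)"
    and Dw': "\<And>x. (w' has_real_derivative w'' x) (at x)"
    and super: "\<And>x. a \<le> x \<Longrightarrow> 2 * (w x)\<^sup>2 \<le> w'' x"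
    and wa: "0 < w a" and w'a: "0 < w' a"
  shows False
proof -
  have w'_ge: "w' a \<le> w' x" if "a \<le> x" for x
    by (rule DERIV_nonneg_imp_nondecreasing[OF that])
      (meson Dw' super order_trans zero_le_power2 mult_nonneg_nonneg zero_le_numeral)
  have w_ge: "w a + w' a * (x - a) \<le> w x" if "a \<le> x" for x
  proof -
    have "w a - w' a * (a - a) \<le> w x - w' a * (x - a)"
    proof (rule DERIV_nonneg_imp_nondecreasing[OF that])
      fix y assume y: "a \<le> y"
      have "((\<lambda>x. w x - w' a * (x - a)) has_real_derivative w' y - w' a) (at y)"
        by (auto intro!: derivative_eq_intros Dw)
      with w'_ge[OF y] show "\<exists>d. ((\<lambda>x. w x - w' a * (x - a)) has_real_derivative d) (at y) \<and> 0 \<le> d"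
        by force
    qed
    then show ?thesis by simp
  qed
  define e where "e = (w' a)\<^sup>2 - 4/3 * w a ^ 3"
  have energy: "e \<le> (w' x)\<^sup>2 - 4/3 * w x ^ 3" if "a \<le> x" for x
    unfolding e_def
  proof (rule DERIV_nonneg_imp_nondecreasing[OF that])
    fix y assume y: "a \<le> y"
    have "((\<lambda>x. (w' x)\<^sup>2 - 4/3 * w x ^ 3) has_real_derivative
        2 * w' y * (w'' y - 2 * (w y)\<^sup>2)) (at y)"
      by (auto intro!: derivative_eq_intros Dw Dw' simp: algebra_simps power2_eq_square)
    moreover have "0 \<le> 2 * w' y * (w'' y - 2 * (w y)\<^sup>2)"
      using super[OF y] w'_ge[OF y] w'a by simp
    ultimately show "\<exists>d. ((\<lambda>x. (w' x)\<^sup>2 - 4/3 * w x ^ 3) has_real_derivative d) (at y) \<and> 0 \<le> d"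
      by blast
  qed
  \<comment> \<open>From \<open>b\<close> on, a third of \<open>w\<^sup>3\<close> outweighs the initial energy.\<close>
  define b where "b = a + (1 + 3 * \<bar>e\<bar>) / w' a"
  have ab: "a \<le> b" using w'a by (simp add: b_def)
  have large: "1 + 3 * \<bar>e\<bar> \<le> w x" if "b \<le> x" for x
  proof -
    have "1 + 3 * \<bar>e\<bar> \<le> w' a * (x - a)"
      using that w'a by (simp add: b_def field_simps)
    also have "\<dots> \<le> w x" using w_ge[of x] wa ab that by simp
    finally show ?thesis .
  qed
  have fast: "w x * sqrt (w x) \<le> w' x" if "b \<le> x" for x
  proof (rule power2_le_imp_le)
    have w1: "1 \<le> w x" using large[OF that] by simp
    have "w x ^ 1 \<le> w x ^ 3" using w1 by (intro power_increasing) auto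
    then have "3 * \<bar>e\<bar> \<le> w x ^ 3" using large[OF that] by simp
    then have "w x ^ 3 \<le> (w' x)\<^sup>2" using energy[of x] ab that by simp
    moreover have "(w x * sqrt (w x))\<^sup>2 = w x ^ 3"
      using w1 by (simp add: power_mult_distrib) (simp add: eval_nat_numeral)
    ultimately show "(w x * sqrt (w x))\<^sup>2 \<le> (w' x)\<^sup>2" by simp
    show "0 \<le> w' x" using w'_ge[of x] w'a ab that by simp
  qed
  define h where "h x = 1 / sqrt (w x)" for x
  have h_pos: "0 < h x" if "b \<le> x" for x
    using large[OF that] by (simp add: h_def)
  define c where "c = b + 2 * h b"
  have bc: "b \<le> c" using h_pos[of b] by (simp add: c_def)
  have "h c + c / 2 \<le> h b + b / 2"
  proof (rule DERIV_nonpos_imp_nonincreasing[OF bc])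
    fix y assume y: "b \<le> y"
    have wy: "0 < w y" using large[OF y] by simp
    have "((\<lambda>x. h x + x / 2) has_real_derivative 1 / 2 - w' y / (2 * (w y * sqrt (w y)))) (at y)"
      unfolding h_def using wy
      by (auto intro!: derivative_eq_intros Dw simp: field_simps)
    moreover have "1 / 2 - w' y / (2 * (w y * sqrt (w y))) \<le> 0"
      using fast[OF y] wy by (simp add: field_simps)
    ultimately show "\<exists>d. ((\<lambda>x. h x + x / 2) has_real_derivative d) (at y) \<and> d \<le> 0"
      by blast
  qed
  then have "h c \<le> 0" using c_def by linarith
  with h_pos[OF bc] show False by simp
qed

section \<open>One component increases, the other decreases\<close>

locale entire_system =
  fixes u v du dv :: "real \<Rightarrow> real"
  assumes u_pos: "0 < u x" and v_pos: "0 < v x"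
    and Du: "(u has_real_derivative du x) (at x)"
    and Dv: "(v has_real_derivative dv x) (at x)"
    and Ddu: "(du has_real_derivative u x * (v x)\<^sup>2) (at x)"
    and Ddv: "(dv has_real_derivative v x * (u x)\<^sup>2) (at x)"
begin

lemma swapped: "entire_system v u dv du"
  by unfold_locales (fact u_pos v_pos Du Dv Ddu Ddv)+

lemma reflected: "entire_system (\<lambda>x. u (- x)) (\<lambda>x. v (- x)) (\<lambda>x. - du (- x)) (\<lambda>x. - dv (- x))"
proof
  fix x
  have R: "((\<lambda>x. f (- x)) has_real_derivative - d) (at x)"
    if "(f has_real_derivative d) (at (- x))" for f :: "real \<Rightarrow> real" and d
    using DERIV_chain2[where f = f and g = uminus, OF that DERIV_minus[OF DERIV_ident]] by simp
  show "((\<lambda>x. u (- x)) has_real_derivative - du (- x)) (at x)" by (rule R[OF Du])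
  show "((\<lambda>x. v (- x)) has_real_derivative - dv (- x)) (at x)" by (rule R[OF Dv])
  show "((\<lambda>x. - du (- x)) has_real_derivative u (- x) * (v (- x))\<^sup>2) (at x)"
    using DERIV_minus[OF R[OF Ddu]] by simp
  show "((\<lambda>x. - dv (- x)) has_real_derivative v (- x) * (u (- x))\<^sup>2) (at x)"
    using DERIV_minus[OF R[OF Ddv]] by simp
qed (simp_all add: u_pos v_pos)

lemma du_strict_mono: "x < y \<Longrightarrow> du x < du y"
  by (erule DERIV_pos_imp_increasing)
    (meson Ddu u_pos v_pos mult_pos_pos zero_less_power)

lemma dv_strict_mono: "x < y \<Longrightarrow> dv x < dv y"
  by (rule entire_system.du_strict_mono[OF swapped])

text \<open>Once both derivatives are nonnegative they stay positive, and then
  \<open>(u v)'' = u v (u\<^sup>2 + v\<^sup>2) + 2 u' v' \<ge> 2 (u v)\<^sup>2\<close>.\<close>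

lemma not_both_nondecreasing: "\<not> (0 \<le> du a \<and> 0 \<le> dv a)"
proof
  assume a: "0 \<le> du a \<and> 0 \<le> dv a"
  have pos: "0 < du x" "0 < dv x" if "a < x" for x
    using du_strict_mono[OF that] dv_strict_mono[OF that] a by auto
  show False
  proof (rule no_global_superquadratic)
    show "((\<lambda>x. u x * v x) has_real_derivative du x * v x + u x * dv x) (at x)" for x
      by (auto intro!: derivative_eq_intros Du Dv)
    show "((\<lambda>x. du x * v x + u x * dv x) has_real_derivative
        u x * v x * ((u x)\<^sup>2 + (v x)\<^sup>2) + 2 * (du x * dv x)) (at x)" for x
      by (auto intro!: derivative_eq_intros Du Dv Ddu Ddv simp: algebra_simps power2_eq_square)
    show "2 * (u x * v x)\<^sup>2 \<le> u x * v x * ((u x)\<^sup>2 + (v x)\<^sup>2) + 2 * (du x * dv x)"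
      if "a + 1 \<le> x" for x
    proof -
      have "2 * u x * v x \<le> (u x)\<^sup>2 + (v x)\<^sup>2" by (rule sum_squares_bound)
      then have "u x * v x * (2 * u x * v x) \<le> u x * v x * ((u x)\<^sup>2 + (v x)\<^sup>2)"
        using u_pos[of x] v_pos[of x] by (intro mult_left_mono) auto
      moreover have "0 < du x * dv x" using pos[of x] that by simp
      ultimately show ?thesis by (simp add: power2_eq_square algebra_simps)
    qed
    show "0 < u (a + 1) * v (a + 1)" by (simp add: u_pos v_pos)
    show "0 < du (a + 1) * v (a + 1) + u (a + 1) * dv (a + 1)"
      using pos[of "a + 1"] by (simp add: u_pos v_pos add_pos_pos)
  qed
qed

lemma opposite_signs: "0 < du x \<and> dv x < 0 \<or> du x < 0 \<and> 0 < dv x"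
  using not_both_nondecreasing[of x] entire_system.not_both_nondecreasing[OF reflected, of "- x"]
  by auto

lemma du_nonzero: "du x \<noteq> 0"
  using opposite_signs[of x] by auto

lemma du_sign_constant: "(\<forall>x. 0 < du x) \<or> (\<forall>x. du x < 0)"
proof (rule ccontr)
  assume "\<not> ?thesis"
  then obtain x y where xy: "du x < 0" "0 < du y"
    by (meson du_nonzero linorder_neqE_linordered_idom)
  then have "x < y" using du_strict_mono[of y x] by (cases x y rule: linorder_cases) auto
  then have "\<exists>z. x \<le> z \<and> z \<le> y \<and> du z = 0"
    using xy Ddu by (intro IVT) (auto intro: DERIV_isCont)
  then show False using du_nonzero by blast
qed

lemma energy_constant:
  "(du x)\<^sup>2 + (dv x)\<^sup>2 - (u x * v x)\<^sup>2 = (du y)\<^sup>2 + (dv y)\<^sup>2 - (u y * v y)\<^sup>2"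
proof -
  have "((\<lambda>x. (du x)\<^sup>2 + (dv x)\<^sup>2 - (u x * v x)\<^sup>2) has_real_derivative 0) (at x)" for x
    by (auto intro!: derivative_eq_intros Du Dv Ddu Ddv simp: algebra_simps power2_eq_square)
  then show ?thesis using DERIV_isconst_all by blast
qed

lemma scaled:
  assumes "0 < l"
  shows "entire_system (scaling l u) (scaling l v) (\<lambda>x. l\<^sup>2 * du (l * x)) (\<lambda>x. l\<^sup>2 * dv (l * x))"
proof
  fix x
  have S: "((\<lambda>x. f (l * x)) has_real_derivative d * l) (at x)"
    if "(f has_real_derivative d) (at (l * x))" for f :: "real \<Rightarrow> real" and d
    by (rule DERIV_chain2[where f = f and g = "\<lambda>x. l * x", OF that DERIV_cmult_Id])
  show "(scaling l u has_real_derivative l\<^sup>2 * du (l * x)) (at x)"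
    unfolding scaling_def using DERIV_cmult[OF S[OF Du], of l]
    by (simp add: power2_eq_square algebra_simps)
  show "(scaling l v has_real_derivative l\<^sup>2 * dv (l * x)) (at x)"
    unfolding scaling_def using DERIV_cmult[OF S[OF Dv], of l]
    by (simp add: power2_eq_square algebra_simps)
  show "((\<lambda>x. l\<^sup>2 * du (l * x)) has_real_derivative scaling l u x * (scaling l v x)\<^sup>2) (at x)"
    unfolding scaling_def using DERIV_cmult[OF S[OF Ddu], of "l\<^sup>2"]
    by (simp add: power2_eq_square algebra_simps)
  show "((\<lambda>x. l\<^sup>2 * dv (l * x)) has_real_derivative scaling l v x * (scaling l u x)\<^sup>2) (at x)"
    unfolding scaling_def using DERIV_cmult[OF S[OF Ddv], of "l\<^sup>2"]
    by (simp add: power2_eq_square algebra_simps)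
qed (use assms in \<open>simp_all add: scaling_def u_pos v_pos\<close>)

end

section \<open>Asymptotics of monotone solutions\<close>

locale monotone_system = entire_system +
  assumes du_pos: "0 < du x" and dv_neg: "dv x < 0"
begin

text \<open>Reflecting the line and exchanging the components preserves the monotonicity of both; this
  duality turns every statement about one component at \<open>+\<infinity>\<close> into one about the other at \<open>-\<infinity>\<close>.\<close>

lemma dual: "monotone_system (\<lambda>x. v (- x)) (\<lambda>x. u (- x)) (\<lambda>x. - dv (- x)) (\<lambda>x. - du (- x))"
  using entire_system.swapped[OF reflected]
  by (simp add: monotone_system_def monotone_system_axioms_def du_pos dv_neg)

lemma u_strict_mono: "x < y \<Longrightarrow> u x < u y"
  by (erule DERIV_pos_imp_increasing) (use Du du_pos in blast)

lemma u_mono: "x \<le> y \<Longrightarrow> u x \<le> u y"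
  using u_strict_mono[of x y] by (cases "x = y") auto

lemma v_antimono: "x \<le> y \<Longrightarrow> v y \<le> v x"
  using monotone_system.u_mono[OF dual, of "- y" "- x"] by simp

lemma du_mono: "x \<le> y \<Longrightarrow> du x \<le> du y"
  using du_strict_mono[of x y] by (cases "x = y") auto

lemma dv_mono: "x \<le> y \<Longrightarrow> dv x \<le> dv y"
  using dv_strict_mono[of x y] by (cases "x = y") auto

text \<open>The quantity \<open>v'\<^sup>2 - u\<^sup>2 v\<^sup>2\<close> is nonincreasing. If it became negative, \<open>u v\<close> would from then on
  be bounded below, hence also \<open>v'' = (u v) u\<close>, and \<open>v'\<close> could not stay negative.\<close>

lemma uv_le_minus_dv: "u x * v x \<le> - dv x"
proof (rule ccontr)
  assume "\<not> ?thesis"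
  then have "(- dv x)\<^sup>2 < (u x * v x)\<^sup>2"
    using dv_neg[of x] by (intro power_strict_mono) auto
  then have less: "(dv x)\<^sup>2 - (u x * v x)\<^sup>2 < 0" by simp
  define c where "c = sqrt ((u x * v x)\<^sup>2 - (dv x)\<^sup>2)"
  have c: "0 < c" using less by (simp add: c_def)
  have noninc: "(dv y)\<^sup>2 - (u y * v y)\<^sup>2 \<le> (dv x)\<^sup>2 - (u x * v x)\<^sup>2" if "x \<le> y" for y
  proof (rule DERIV_nonpos_imp_nonincreasing[OF that])
    fix z
    have "((\<lambda>x. (dv x)\<^sup>2 - (u x * v x)\<^sup>2) has_real_derivative - (2 * u z * du z * (v z)\<^sup>2)) (at z)"
      by (auto intro!: derivative_eq_intros Du Dv Ddv simp: algebra_simps power2_eq_square)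
    moreover have "- (2 * u z * du z * (v z)\<^sup>2) \<le> 0"
      using u_pos[of z] du_pos[of z] by simp
    ultimately show "\<exists>d. ((\<lambda>x. (dv x)\<^sup>2 - (u x * v x)\<^sup>2) has_real_derivative d) (at z) \<and> d \<le> 0"
      by blast
  qed
  have uv_ge: "c \<le> u y * v y" if "x \<le> y" for y
  proof (rule power2_le_imp_le)
    have "(u x * v x)\<^sup>2 - (dv x)\<^sup>2 \<le> (u y * v y)\<^sup>2" using noninc[OF that] zero_le_power2[of "dv y"] by linarith
    then show "c\<^sup>2 \<le> (u y * v y)\<^sup>2" using less by (simp add: c_def)
    show "0 \<le> u y * v y" using u_pos[of y] v_pos[of y] by simp
  qed
  define y where "y = x - dv x / (c * u x)"
  have xy: "x \<le> y" using dv_neg[of x] c u_pos[of x] by (simp add: y_def divide_nonpos_pos)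
  have "dv x - c * u x * x \<le> dv y - c * u x * y"
  proof (rule DERIV_nonneg_imp_nondecreasing[OF xy])
    fix z assume z: "x \<le> z"
    have "((\<lambda>y. dv y - c * u x * y) has_real_derivative v z * (u z)\<^sup>2 - c * u x) (at z)"
      by (auto intro!: derivative_eq_intros Ddv)
    moreover have "c * u x \<le> (u z * v z) * u z"
      using uv_ge[OF z] u_mono[OF z] c u_pos[of x] u_pos[of z] v_pos[of z]
      by (intro mult_mono) auto
    then have "0 \<le> v z * (u z)\<^sup>2 - c * u x" by (simp add: power2_eq_square mult_ac)
    ultimately show "\<exists>d. ((\<lambda>y. dv y - c * u x * y) has_real_derivative d) (at z) \<and> 0 \<le> d"
      by blast
  qed
  moreover have "c * u x * y = c * u x * x - dv x"
    using c u_pos[of x] by (simp add: y_def field_simps)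
  ultimately have "0 \<le> dv y" by simp
  with dv_neg[of y] show False by simp
qed

lemma uv_le_du: "u x * v x \<le> du x"
  using monotone_system.uv_le_minus_dv[OF dual, of "- x"] by (simp add: mult.commute)

lemma uv_square_le_dv_square: "(u x * v x)\<^sup>2 \<le> (dv x)\<^sup>2"
  using power_mono[OF uv_le_minus_dv[of x], of 2] u_pos[of x] v_pos[of x] by simp

lemma uv_square_le_du_square: "(u x * v x)\<^sup>2 \<le> (du x)\<^sup>2"
  using power_mono[OF uv_le_du[of x], of 2] u_pos[of x] v_pos[of x] by simp

lemma u_at_top: "filterlim u at_top at_top"
proof (rule filterlim_at_top_mono)
  show "filterlim (\<lambda>x. u 0 + du 0 * x) at_top at_top"
    by (rule filterlim_tendsto_add_at_top[OF tendsto_const],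
        rule filterlim_tendsto_pos_mult_at_top[OF tendsto_const du_pos filterlim_ident])
  have "u 0 + du 0 * x \<le> u x" if "0 \<le> x" for x
  proof -
    have "u 0 - du 0 * 0 \<le> u x - du 0 * x"
    proof (rule DERIV_nonneg_imp_nondecreasing[OF that])
      fix z :: real assume z: "0 \<le> z"
      have "((\<lambda>y. u y - du 0 * y) has_real_derivative du z - du 0) (at z)"
        by (auto intro!: derivative_eq_intros Du)
      then show "\<exists>d. ((\<lambda>y. u y - du 0 * y) has_real_derivative d) (at z) \<and> 0 \<le> d"
        using du_mono[OF z] by force
    qed
    then show ?thesis by simp
  qed
  then show "eventually (\<lambda>x. u 0 + du 0 * x \<le> u x) at_top"
    using eventually_at_top_linorder by blast
qed

lemma v_at_bot: "filterlim v at_top at_bot"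
  using monotone_system.u_at_top[OF dual] by (simp add: filterlim_at_bot_mirror)

lemma dv_at_top: "(dv \<longlongrightarrow> 0) at_top"
proof (rule order_tendstoI)
  fix e :: real assume "0 < e"
  then show "eventually (\<lambda>x. dv x < e) at_top"
    using dv_neg by (intro always_eventually allI) (meson less_trans)
next
  fix e :: real assume e: "e < 0"
  have "\<exists>y. e < dv y"
  proof (rule ccontr)
    assume "\<not> ?thesis"
    then have le: "dv y \<le> e" for y by (simp add: not_less)
    define y where "y = - v 0 / e"
    have y: "0 \<le> y" using e v_pos[of 0] by (simp add: y_def divide_nonneg_neg)
    have "v y - e * y \<le> v 0 - e * 0"
    proof (rule DERIV_nonpos_imp_nonincreasing[OF y])
      fix z
      have "((\<lambda>y. v y - e * y) has_real_derivative dv z - e) (at z)"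
        by (auto intro!: derivative_eq_intros Dv)
      then show "\<exists>d. ((\<lambda>y. v y - e * y) has_real_derivative d) (at z) \<and> d \<le> 0"
        using le[of z] by force
    qed
    then have "v y \<le> 0" using e by (simp add: y_def)
    with v_pos[of y] show False by simp
  qed
  then obtain y where "e < dv y" by blast
  then show "eventually (\<lambda>x. e < dv x) at_top"
    unfolding eventually_at_top_linorder using dv_mono by (meson less_le_trans)
qed

lemma slope_at_top: "((\<lambda>x. dv x / du x) \<longlongrightarrow> 0) at_top"
proof (rule tendsto_sandwich)
  show "((\<lambda>x. dv x / du 0) \<longlongrightarrow> 0) at_top"
    using tendsto_divide[OF dv_at_top tendsto_const, of "du 0"] du_pos[of 0] by simp
  have "dv x / du 0 \<le> dv x / du x" if "0 \<le> x" for x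
    using du_mono[OF that] du_pos[of 0] du_pos[of x] dv_neg[of x]
    by (intro divide_left_mono_neg) auto
  then show "eventually (\<lambda>x. dv x / du 0 \<le> dv x / du x) at_top"
    using eventually_at_top_linorder by blast
  show "eventually (\<lambda>x. dv x / du x \<le> 0) at_top"
    using du_pos dv_neg by (intro always_eventually allI divide_nonpos_pos) (auto intro: less_imp_le)
qed simp

lemma inverse_slope_at_bot: "((\<lambda>x. du x / dv x) \<longlongrightarrow> 0) at_bot"
  using monotone_system.slope_at_top[OF dual] by (simp add: filterlim_at_bot_mirror)

lemma u_at_bot: "(u \<longlongrightarrow> 0) at_bot"
proof (rule tendsto_sandwich[where f = "\<lambda>_. 0"])
  have "(du \<longlongrightarrow> 0) at_bot"
    using tendsto_minus[OF monotone_system.dv_at_top[OF dual]] by (simp add: filterlim_at_bot_mirror)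
  from tendsto_divide[OF this tendsto_const, of "v 0"]
  show "((\<lambda>x. du x / v 0) \<longlongrightarrow> 0) at_bot" using v_pos[of 0] by simp
  have "u x \<le> du x / v 0" if "x \<le> 0" for x
  proof -
    have "u x * v 0 \<le> u x * v x"
      using v_antimono[OF that] u_pos[of x] by (intro mult_left_mono) auto
    then show ?thesis using uv_le_du[of x] v_pos[of 0] by (simp add: field_simps)
  qed
  then show "eventually (\<lambda>x. u x \<le> du x / v 0) at_bot"
    using eventually_at_bot_linorder by blast
  show "eventually (\<lambda>x. 0 \<le> u x) at_bot"
    by (intro always_eventually allI less_imp_le u_pos)
qed simp

lemma u_inv: "u (inv u s) = s" if s: "0 < s"
proof -
  obtain x where x: "u x < s"
    using eventually_happens[OF order_tendstoD(2)[OF u_at_bot s]] by auto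
  obtain y where y: "s < u y"
    using eventually_happens[OF u_at_top[unfolded filterlim_at_top_dense, rule_format, of s]] by auto
  have "x \<le> y" using x y u_mono[of y x] by linarith
  then have "\<exists>z. x \<le> z \<and> z \<le> y \<and> u z = s"
    using x y Du by (intro IVT) (auto intro: DERIV_isCont)
  then show ?thesis by (auto intro: f_inv_into_f)
qed

lemma inv_u: "inv u (u x) = x"
proof (rule inv_f_f, rule injI)
  fix x y assume "u x = u y"
  then show "x = y" using u_strict_mono[of x y] u_strict_mono[of y x] by (cases x y rule: linorder_cases) auto
qed

lemma D_inv_u:
  assumes s: "0 < s"
  shows "(inv u has_real_derivative inverse (du (inv u s))) (at s)"
proof (rule DERIV_inverse_function)
  show "(u has_real_derivative du (inv u s)) (at (inv u s))" by (rule Du)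
  show "du (inv u s) \<noteq> 0" by (rule du_nonzero)
  show "0 < s" "s < s + 1" using s by auto
  show "u (inv u y) = y" if "0 < y" for y by (rule u_inv[OF that])
  have "isCont (inv u) (u (inv u s))"
    by (rule isCont_inverse_function[where d = 1]) (auto simp: inv_u intro: DERIV_isCont Du)
  then show "isCont (inv u) s" by (simp add: u_inv[OF s])
qed

lemma inv_u_at_top: "filterlim (inv u) at_top at_top"
  unfolding filterlim_at_top
proof
  fix z
  have "z \<le> inv u s" if "u z \<le> s" for s
    using that u_inv[of s] u_pos[of z] u_strict_mono[of "inv u s" z] by linarith
  then show "eventually (\<lambda>s. z \<le> inv u s) at_top"
    using eventually_at_top_linorder by blast
qed

lemma inv_u_at_right_0: "filterlim (inv u) at_bot (at_right 0)"
  unfolding filterlim_at_bot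
proof
  fix z
  have "inv u s \<le> z" if "0 < s" "s < u z" for s
    using that u_inv[of s] u_strict_mono[of z "inv u s"] by linarith
  then show "eventually (\<lambda>s. inv u s \<le> z) (at_right 0)"
    unfolding eventually_at_right_field using u_pos[of z] by blast
qed

end

section \<open>Geodesic graphs in the quadrant\<close>

text \<open>The integral of \<open>\<partial>\<phi>/\<partial>s = s y\<^sup>2 / (1 + s\<^sup>2 y\<^sup>2)\<close> over \<open>0 \<le> y \<le> t\<close>, in closed form.\<close>

definition angle_correction :: "real \<Rightarrow> real \<Rightarrow> real" where
  "angle_correction s t = t / s - arctan (s * t) / s\<^sup>2"

definition corrected_angle :: "(real \<Rightarrow> real) \<Rightarrow> (real \<Rightarrow> real) \<Rightarrow> real \<Rightarrow> real" where
  "corrected_angle f p s = arctan (p s) + angle_correction s (f s)"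

text \<open>This is \<open>\<partial>\<phi>/\<partial>t\<close> plus the derivative of \<open>angle_correction\<close> in its first argument, where
  \<open>\<phi> = ln (1 + s\<^sup>2 t\<^sup>2) / 2\<close>.\<close>

definition \<kappa> :: "real \<Rightarrow> real \<Rightarrow> real" where
  "\<kappa> s t = s\<^sup>2 * t / (1 + (s * t)\<^sup>2) + 2 * arctan (s * t) / s ^ 3 - t / s\<^sup>2
     - t / (s\<^sup>2 * (1 + (s * t)\<^sup>2))"

text \<open>The derivative of \<open>\<kappa> s\<close> is \<open>\<Delta>\<phi>\<close>, that is, minus the curvature times the conformal factor.\<close>

lemma \<kappa>_derivative:
  assumes "0 < s"
  shows "(\<kappa> s has_real_derivative
    (1 - (s * t)\<^sup>2) * (s\<^sup>2 + t\<^sup>2) / (1 + (s * t)\<^sup>2)\<^sup>2) (at t)"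
proof -
  define F where "F = 1 + (s * t)\<^sup>2"
  have F: "0 < F" by (simp add: F_def add_pos_nonneg)
  have DF: "((\<lambda>t. 1 + (s * t)\<^sup>2) has_real_derivative 2 * s\<^sup>2 * t) (at t)"
    by (auto intro!: derivative_eq_intros simp: power2_eq_square)
  have "((\<lambda>t. s\<^sup>2 * t / (1 + (s * t)\<^sup>2)) has_real_derivative
      (s\<^sup>2 * F - s\<^sup>2 * t * (2 * s\<^sup>2 * t)) / (F * F)) (at t)"
    unfolding F_def by (rule DERIV_divide[OF DERIV_cmult_Id DF]) (use F in \<open>simp add: F_def\<close>)
  moreover have "((\<lambda>t. 2 * arctan (s * t) / s ^ 3) has_real_derivative 2 * (inverse F * s) / s ^ 3) (at t)"
    unfolding F_def by (intro DERIV_cdivide DERIV_cmult DERIV_chain2[OF DERIV_arctan] DERIV_cmult_Id)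
  moreover have "((\<lambda>t. t / s\<^sup>2) has_real_derivative 1 / s\<^sup>2) (at t)"
    by (intro DERIV_cdivide DERIV_ident)
  moreover have "((\<lambda>t. t / (s\<^sup>2 * (1 + (s * t)\<^sup>2))) has_real_derivative
      (1 * (s\<^sup>2 * F) - t * (s\<^sup>2 * (2 * s\<^sup>2 * t))) / ((s\<^sup>2 * F) * (s\<^sup>2 * F))) (at t)"
    unfolding F_def by (rule DERIV_divide[OF DERIV_ident DERIV_cmult[OF DF]])
      (use F assms in \<open>simp add: F_def\<close>)
  ultimately have "(\<kappa> s has_real_derivative
      (s\<^sup>2 * F - s\<^sup>2 * t * (2 * s\<^sup>2 * t)) / (F * F) + 2 * (inverse F * s) / s ^ 3 - 1 / s\<^sup>2
       - (1 * (s\<^sup>2 * F) - t * (s\<^sup>2 * (2 * s\<^sup>2 * t))) / ((s\<^sup>2 * F) * (s\<^sup>2 * F))) (at t)"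
    unfolding \<kappa>_def[abs_def] by (intro DERIV_diff DERIV_add)
  moreover have "(s\<^sup>2 * F - s\<^sup>2 * t * (2 * s\<^sup>2 * t)) / (F * F) + 2 * (inverse F * s) / s ^ 3 - 1 / s\<^sup>2
       - (1 * (s\<^sup>2 * F) - t * (s\<^sup>2 * (2 * s\<^sup>2 * t))) / ((s\<^sup>2 * F) * (s\<^sup>2 * F)) =
     (s ^ 4 * F - s ^ 4 * t * (2 * s\<^sup>2 * t) + 2 * F - F\<^sup>2 - (F - t * (2 * s\<^sup>2 * t))) / (s\<^sup>2 * F\<^sup>2)"
    using assms F by (simp add: divide_simps) algebra
  moreover have "s ^ 4 * F - s ^ 4 * t * (2 * s\<^sup>2 * t) + 2 * F - F\<^sup>2 - (F - t * (2 * s\<^sup>2 * t)) =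
     s\<^sup>2 * ((1 - (s * t)\<^sup>2) * (s\<^sup>2 + t\<^sup>2))"
    unfolding F_def by algebra
  ultimately show ?thesis using assms by (simp add: F_def)
qed

lemma \<kappa>_strict_mono:
  assumes s: "0 < s" and t: "0 < t1" "t1 < t2" "s * t2 \<le> 1"
  shows "\<kappa> s t1 < \<kappa> s t2"
proof (rule DERIV_pos_imp_increasing_open[OF t(2)])
  show "continuous_on {t1..t2} (\<kappa> s)"
    by (rule DERIV_continuous_on[OF has_field_derivative_at_within[OF \<kappa>_derivative[OF s]]])
  fix t assume "t1 < t" "t < t2"
  then have "s * t < s * t2" "0 < t" using s t by auto
  then have "s * t < 1" using t by simp
  then have "(s * t)\<^sup>2 < 1" using s \<open>0 < t\<close> by (simp add: abs_square_less_1)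
  then have "0 < (1 - (s * t)\<^sup>2) * (s\<^sup>2 + t\<^sup>2) / (1 + (s * t)\<^sup>2)\<^sup>2"
    using s by (intro divide_pos_pos mult_pos_pos zero_less_power add_pos_nonneg) auto
  with \<kappa>_derivative[OF s] show "\<exists>d. (\<kappa> s has_real_derivative d) (at t) \<and> 0 < d" by blast
qed

lemma arctan_ge_cubic:
  assumes "0 \<le> y"
  shows "y - y ^ 3 / 3 \<le> arctan y"
proof -
  have "arctan 0 - (0 - 0 ^ 3 / 3) \<le> arctan y - (y - y ^ 3 / 3)"
  proof (rule DERIV_nonneg_imp_nondecreasing[OF assms])
    fix z :: real
    have F: "0 < 1 + z\<^sup>2" by (simp add: add_pos_nonneg)
    have "((\<lambda>y. arctan y - (y - y ^ 3 / 3)) has_real_derivative z ^ 4 / (1 + z\<^sup>2)) (at z)"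
      using F by (auto intro!: derivative_eq_intros simp: field_simps power2_eq_square power4_eq_xxxx)
    then show "\<exists>d. ((\<lambda>y. arctan y - (y - y ^ 3 / 3)) has_real_derivative d) (at z) \<and> 0 \<le> d"
      using F by force
  qed
  then show ?thesis by simp
qed

lemma arctan_le_self:
  assumes "0 \<le> y"
  shows "arctan y \<le> y"
proof -
  have "arctan y - y \<le> arctan 0 - 0"
  proof (rule DERIV_nonpos_imp_nonincreasing[OF assms])
    fix z :: real
    have F: "0 < 1 + z\<^sup>2" by (simp add: add_pos_nonneg)
    have "((\<lambda>y. arctan y - y) has_real_derivative - (z\<^sup>2 / (1 + z\<^sup>2))) (at z)"
      using F by (auto intro!: derivative_eq_intros simp: field_simps)
    then show "\<exists>d. ((\<lambda>y. arctan y - y) has_real_derivative d) (at z) \<and> d \<le> 0"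
      using F by force
  qed
  then show ?thesis by simp
qed

lemma angle_correction_bounds:
  assumes "0 < s" "0 < t"
  shows "0 \<le> angle_correction s t" "angle_correction s t \<le> t / s"
    "angle_correction s t \<le> s * t ^ 3 / 3"
proof -
  have eq: "angle_correction s t = (s * t - arctan (s * t)) / s\<^sup>2"
    using assms by (simp add: angle_correction_def field_simps power2_eq_square)
  show "0 \<le> angle_correction s t"
    unfolding eq using arctan_le_self[of "s * t"] assms by simp
  show "angle_correction s t \<le> t / s"
    unfolding angle_correction_def using assms by simp
  have "angle_correction s t \<le> ((s * t) ^ 3 / 3) / s\<^sup>2"
    unfolding eq using arctan_ge_cubic[of "s * t"] assms by (intro divide_right_mono) auto
  also have "\<dots> = s * t ^ 3 / 3"
    using assms by (simp add: field_simps power2_eq_square power3_eq_cube)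
  finally show "angle_correction s t \<le> s * t ^ 3 / 3" .
qed

text \<open>A graph in the region of nonpositive curvature. The fourth assumption is the geodesic equation,
  and the last two give the corrected angle the limits it has along a curve that is asymptotic to
  the positive second axis and to the positive first axis.\<close>

locale phase_curve =
  fixes f p :: "real \<Rightarrow> real"
  assumes f_pos: "0 < s \<Longrightarrow> 0 < f s"
    and below_hyperbola: "0 < s \<Longrightarrow> s * f s \<le> 1"
    and Df: "0 < s \<Longrightarrow> (f has_real_derivative p s) (at s)"
    and D_angle: "0 < s \<Longrightarrow> (corrected_angle f p has_real_derivative \<kappa> s (f s)) (at s)"
    and angle_at_0: "(corrected_angle f p \<longlongrightarrow> - (pi / 2)) (at_right 0)"
    and angle_at_top: "(corrected_angle f p \<longlongrightarrow> 0) at_top"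

lemma first_zero:
  fixes D :: "real \<Rightarrow> real"
  assumes "0 < D a" "a \<le> c" "D c \<le> 0" "continuous_on {a..c} D"
  obtains b where "a < b" "b \<le> c" "D b = 0" "\<And>s. a \<le> s \<Longrightarrow> s < b \<Longrightarrow> 0 < D s"
proof -
  have zero_between: "\<exists>z. a \<le> z \<and> z \<le> s \<and> D z = 0" if "a \<le> s" "s \<le> c" "D s \<le> 0" for s
    by (rule IVT2') (use that assms in \<open>auto intro: continuous_on_subset\<close>)
  define Z where "Z = D -` {0} \<inter> {a..c}"
  have "closed Z"
    unfolding Z_def using assms(4) by (simp add: continuous_on_closed_vimage)
  then have "compact Z"
    using compact_Int_closed[of "{a..c}" Z] by (simp add: Z_def Int_commute)
  moreover have "Z \<noteq> {}" using zero_between[of c] assms by (auto simp: Z_def)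
  ultimately obtain b where b: "b \<in> Z" "\<And>s. s \<in> Z \<Longrightarrow> b \<le> s"
    by (metis compact_attains_inf)
  show thesis
  proof
    show "a < b" using b(1) assms(1) by (cases "a = b") (auto simp: Z_def)
    show "b \<le> c" "D b = 0" using b(1) by (auto simp: Z_def)
    fix s assume s: "a \<le> s" "s < b"
    show "0 < D s"
    proof (rule ccontr)
      assume "\<not> 0 < D s"
      with zero_between[of s] s \<open>b \<le> c\<close> obtain z where "a \<le> z" "z \<le> s" "D z = 0" by auto
      with b(2)[of z] s \<open>b \<le> c\<close> show False by (simp add: Z_def)
    qed
  qed
qed

lemma last_zero:
  fixes D :: "real \<Rightarrow> real"
  assumes "0 < D a" "c \<le> a" "D c \<le> 0" "continuous_on {c..a} D"
  obtains b where "c \<le> b" "b < a" "D b = 0" "\<And>s. b < s \<Longrightarrow> s \<le> a \<Longrightarrow> 0 < D s"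
proof -
  have "continuous_on {- a..- c} (\<lambda>x. D (- x))"
    by (rule continuous_on_compose2[OF assms(4)]) (auto intro!: continuous_intros)
  from first_zero[of "\<lambda>x. D (- x)" "- a" "- c", OF _ _ _ this] assms(1-3)
  obtain b where b: "- a < b" "b \<le> - c" "D (- b) = 0" "\<And>s. - a \<le> s \<Longrightarrow> s < b \<Longrightarrow> 0 < D (- s)"
    by auto
  show thesis
  proof (rule that)
    show "c \<le> - b" "- b < a" "D (- b) = 0" using b(1-3) by auto
    show "0 < D s" if "- b < s" "s \<le> a" for s using b(4)[of "- s"] that by simp
  qed
qed

text \<open>Let \<open>D\<close> and \<open>G\<close> be the differences of the graphs and of the corrected angles, and suppose
  \<open>D > 0\<close> at \<open>a\<close>. As long as \<open>D > 0\<close>, \<open>G\<close> increases strictly. To the right, either \<open>D\<close> first vanishes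
  at some \<open>b\<close>, where the two correction terms agree and the slope of \<open>D\<close> is nonpositive, so that
  \<open>G b \<le> 0\<close>; or \<open>D\<close> stays positive and \<open>G\<close> tends to 0. Either way \<open>G a < 0\<close>. In the same
  way, going to the left shows \<open>G a > 0\<close>.\<close>

lemma phase_curve_le:
  assumes "phase_curve f1 p1" "phase_curve f2 p2" and a: "0 < a"
  shows "f1 a \<le> f2 a"
proof (rule ccontr)
  interpret c1: phase_curve f1 p1 by fact
  interpret c2: phase_curve f2 p2 by fact
  define D where "D s = f1 s - f2 s" for s
  define G where "G s = corrected_angle f1 p1 s - corrected_angle f2 p2 s" for s
  assume "\<not> ?thesis"
  then have Da: "0 < D a" by (simp add: D_def)
  have DD: "(D has_real_derivative p1 s - p2 s) (at s)" if "0 < s" for s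
    unfolding D_def[abs_def] by (intro DERIV_diff c1.Df c2.Df that)
  have DG: "(G has_real_derivative \<kappa> s (f1 s) - \<kappa> s (f2 s)) (at s)" if "0 < s" for s
    unfolding G_def[abs_def] by (intro DERIV_diff c1.D_angle c2.D_angle that)
  have contD: "continuous_on {x..y} D" if "0 < x" for x y
    by (intro continuous_at_imp_continuous_on ballI DERIV_isCont[OF DD]) (use that in auto)
  have contG: "continuous_on {x..y} G" if "0 < x" for x y
    by (intro continuous_at_imp_continuous_on ballI DERIV_isCont[OF DG]) (use that in auto)
  have G_increases: "G x < G y"
    if "0 < x" "x < y" and pos: "\<And>s. x < s \<Longrightarrow> s < y \<Longrightarrow> 0 < D s" for x y
  proof (rule DERIV_pos_imp_increasing_open[OF that(2) _ contG[OF that(1)]])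
    fix s assume s: "x < s" "s < y"
    then have s0: "0 < s" using that(1) by simp
    have "\<kappa> s (f2 s) < \<kappa> s (f1 s)"
      using pos[OF s] by (intro \<kappa>_strict_mono s0 c2.f_pos c1.below_hyperbola) (simp add: D_def)
    then show "\<exists>d. (G has_real_derivative d) (at s) \<and> 0 < d" using DG[OF s0] by force
  qed
  have G_at_zero: "G b = arctan (p1 b) - arctan (p2 b)" if "D b = 0" for b
    using that by (simp add: G_def D_def corrected_angle_def)
  have "G a < 0"
  proof (cases "\<forall>s\<ge>a. 0 < D s")
    case True
    have "(G \<longlongrightarrow> 0) at_top"
      unfolding G_def using tendsto_diff[OF c1.angle_at_top c2.angle_at_top] by simp
    moreover have "G (a + 1) \<le> G s" if "a + 1 \<le> s" for s
      using G_increases[of "a + 1" s] that a True by (cases "s = a + 1") auto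
    then have "eventually (\<lambda>s. G (a + 1) \<le> G s) at_top"
      using eventually_at_top_linorder by blast
    ultimately have "G (a + 1) \<le> 0" by (rule tendsto_lowerbound) simp
    moreover have "G a < G (a + 1)" using a True by (intro G_increases) auto
    ultimately show ?thesis by simp
  next
    case False
    then obtain c where "a \<le> c" "D c \<le> 0" by (auto simp: not_less)
    from first_zero[OF Da this contD[OF a]] obtain b
      where b: "a < b" "D b = 0" "\<And>s. a \<le> s \<Longrightarrow> s < b \<Longrightarrow> 0 < D s" by metis
    have b0: "0 < b" using a b by simp
    have "p1 b \<le> p2 b"
    proof (rule ccontr)
      assume "\<not> ?thesis"
      then obtain d where d: "0 < d" "\<And>h. 0 < h \<Longrightarrow> h < d \<Longrightarrow> D (b - h) < D b"
        using DERIV_pos_inc_left[OF DD[OF b0]] by auto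
      define h where "h = min d (b - a) / 2"
      have "0 < h" "h < d" "h < b - a" using d(1) b(1) by (auto simp: h_def)
      then show False using d(2)[of h] b(2) b(3)[of "b - h"] by auto
    qed
    then have "G b \<le> 0" using G_at_zero[OF b(2)] by (simp add: arctan_le_iff)
    moreover have "G a < G b" using a b by (intro G_increases) auto
    ultimately show ?thesis by simp
  qed
  moreover have "0 < G a"
  proof (cases "\<forall>s\<le>a. 0 < s \<longrightarrow> 0 < D s")
    case True
    have "(G \<longlongrightarrow> 0) (at_right 0)"
      unfolding G_def using tendsto_diff[OF c1.angle_at_0 c2.angle_at_0] by simp
    moreover have "G s \<le> G (a / 2)" if "0 < s" "s < a / 2" for s
      using G_increases[of s "a / 2"] that a True by auto
    then have "eventually (\<lambda>s. G s \<le> G (a / 2)) (at_right 0)"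
      unfolding eventually_at_right_field using a by (intro exI[of _ "a / 2"]) auto
    ultimately have "0 \<le> G (a / 2)" by (rule tendsto_upperbound) simp
    moreover have "G (a / 2) < G a" using a True by (intro G_increases) auto
    ultimately show ?thesis by simp
  next
    case False
    then obtain c where c: "0 < c" "c \<le> a" "D c \<le> 0" by (auto simp: not_less)
    from last_zero[OF Da c(2,3) contD[OF c(1)]] obtain b
      where b: "c \<le> b" "b < a" "D b = 0" "\<And>s. b < s \<Longrightarrow> s \<le> a \<Longrightarrow> 0 < D s" by metis
    have b0: "0 < b" using c b by simp
    have "p2 b \<le> p1 b"
    proof (rule ccontr)
      assume "\<not> ?thesis"
      then obtain d where d: "0 < d" "\<And>h. 0 < h \<Longrightarrow> h < d \<Longrightarrow> D (b + h) < D b"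
        using DERIV_neg_dec_right[OF DD[OF b0]] by auto
      define h where "h = min d (a - b) / 2"
      have "0 < h" "h < d" "h < a - b" using d(1) b(2) by (auto simp: h_def)
      then show False using d(2)[of h] b(3) b(4)[of "b + h"] by auto
    qed
    then have "0 \<le> G b" using G_at_zero[OF b(3)] by (simp add: arctan_le_iff)
    moreover have "G b < G a" using b0 b by (intro G_increases) auto
    ultimately show ?thesis by simp
  qed
  ultimately show False by simp
qed

section \<open>Normalised solutions and their graphs\<close>

locale normalised_system = monotone_system +
  assumes energy: "(du x)\<^sup>2 + (dv x)\<^sup>2 = 1 + (u x * v x)\<^sup>2"
begin

lemma uv_le_1: "u x * v x \<le> 1"
proof (rule power2_le_imp_le)
  show "(u x * v x)\<^sup>2 \<le> 1\<^sup>2"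
    using energy[of x] uv_square_le_du_square[of x] uv_square_le_dv_square[of x] by simp
qed simp

lemma minus_dv_le_1: "- dv x \<le> 1"
proof (rule power2_le_imp_le)
  show "(- dv x)\<^sup>2 \<le> 1\<^sup>2"
    using energy[of x] uv_square_le_du_square[of x] by simp
qed simp

text \<open>This bounds the correction of the angle at \<open>-\<infinity>\<close>. Since \<open>u' \<ge> u v\<close> and \<open>v' \<ge> -1\<close>, the derivative
  of \<open>u v\<^sup>4\<close> is at least \<open>u v\<^sup>3 (v\<^sup>2 - 4)\<close>, which is nonnegative once \<open>v \<ge> 4\<close>. Hence \<open>u v\<^sup>4\<close> is
  bounded towards \<open>-\<infinity>\<close>, while \<open>v\<close> tends to infinity there.\<close>

lemma u_v_cubed_at_bot: "((\<lambda>x. u x * v x ^ 3) \<longlongrightarrow> 0) at_bot"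
proof -
  have "eventually (\<lambda>x. 4 \<le> v x) at_bot"
    using v_at_bot by (simp add: filterlim_at_top)
  then obtain b where b: "\<And>x. x \<le> b \<Longrightarrow> 4 \<le> v x"
    unfolding eventually_at_bot_linorder by blast
  define C where "C = u b * v b ^ 4"
  have bound: "u x * v x ^ 4 \<le> C" if "x \<le> b" for x
    unfolding C_def
  proof (rule DERIV_nonneg_imp_nondecreasing[OF that])
    fix z assume z: "z \<le> b"
    have v4: "4 \<le> v z" by (rule b[OF z])
    have D: "((\<lambda>x. u x * v x ^ 4) has_real_derivative
        v z ^ 3 * (du z * v z + 4 * u z * dv z)) (at z)"
      by (auto intro!: derivative_eq_intros Du Dv simp: algebra_simps eval_nat_numeral)
    have "0 \<le> u z * (v z * v z - 4)"
      using u_pos[of z] mult_mono[of 4 "v z" 1 "v z"] v4 by simp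
    also have "\<dots> = u z * v z * v z + 4 * u z * (- 1)" by (simp add: algebra_simps)
    also have "\<dots> \<le> du z * v z + 4 * u z * dv z"
      using uv_le_du[of z] v_pos[of z] u_pos[of z] minus_dv_le_1[of z]
      by (intro add_mono mult_right_mono mult_left_mono) auto
    finally have "0 \<le> v z ^ 3 * (du z * v z + 4 * u z * dv z)"
      using v_pos[of z] by simp
    with D show "\<exists>d. ((\<lambda>x. u x * v x ^ 4) has_real_derivative d) (at z) \<and> 0 \<le> d" by blast
  qed
  show ?thesis
  proof (rule tendsto_sandwich[where f = "\<lambda>_. 0"])
    show "((\<lambda>x. C / v x) \<longlongrightarrow> 0) at_bot"
      by (rule tendsto_divide_0[OF tendsto_const]) (rule filterlim_at_top_imp_at_infinity[OF v_at_bot])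
    have "u x * v x ^ 3 \<le> C / v x" if "x \<le> b" for x
      using bound[OF that] v_pos[of x] by (simp add: field_simps eval_nat_numeral)
    then show "eventually (\<lambda>x. u x * v x ^ 3 \<le> C / v x) at_bot"
      using eventually_at_bot_linorder by blast
    show "eventually (\<lambda>x. 0 \<le> u x * v x ^ 3) at_bot"
      using u_pos v_pos by (intro always_eventually allI mult_nonneg_nonneg zero_le_power less_imp_le)
  qed simp
qed

abbreviation angle :: "real \<Rightarrow> real" where
  "angle x \<equiv> arctan (dv x / du x) + angle_correction (u x) (v x)"

text \<open>The equations give \<open>v'' u' - v' u'' = u v (u u' - v v')\<close>, and the conserved quantity turns the
  denominator \<open>u'\<^sup>2 + v'\<^sup>2\<close> of the derivative of \<open>arctan (v'/u')\<close> into \<open>1 + u\<^sup>2 v\<^sup>2\<close>. What is left of \<open>v'\<close>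
  is exactly compensated by the correction term.\<close>

lemma D_angle: "(angle has_real_derivative du x * \<kappa> (u x) (v x)) (at x)"
proof -
  define F where "F = 1 + (u x * v x)\<^sup>2"
  have F: "0 < F" by (simp add: F_def add_pos_nonneg)
  have F': "(du x)\<^sup>2 + (dv x)\<^sup>2 = F" by (simp add: F_def energy)
  have u0: "u x \<noteq> 0" "du x \<noteq> 0" using u_pos[of x] du_nonzero[of x] by auto
  have slope: "((\<lambda>x. arctan (dv x / du x)) has_real_derivative
      (v x * (u x)\<^sup>2 * du x - dv x * (u x * (v x)\<^sup>2)) / F) (at x)"
  proof -
    have "1 + (dv x / du x)\<^sup>2 = F / (du x)\<^sup>2"
      unfolding F'[symmetric] using u0 by (simp add: field_simps)
    then have "inverse (1 + (dv x / du x)\<^sup>2) * ((v x * (u x)\<^sup>2 * du x - dv x * (u x * (v x)\<^sup>2)) / (du x * du x))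
       = (v x * (u x)\<^sup>2 * du x - dv x * (u x * (v x)\<^sup>2)) / F"
      using u0 F by (simp add: power2_eq_square)
    with DERIV_chain2[OF DERIV_arctan DERIV_divide[OF Ddv Ddu u0(2)]] show ?thesis by simp
  qed
  have corr: "((\<lambda>x. angle_correction (u x) (v x)) has_real_derivative
      (dv x * u x - v x * du x) / (u x * u x)
      - (inverse F * (du x * v x + dv x * u x) * (u x)\<^sup>2 - arctan (u x * v x) * (2 * u x * du x))
        / ((u x)\<^sup>2 * (u x)\<^sup>2)) (at x)"
    unfolding angle_correction_def F_def
  proof (intro DERIV_diff DERIV_divide Du Dv DERIV_chain2[OF DERIV_arctan] DERIV_mult)
    show "((\<lambda>x. (u x)\<^sup>2) has_real_derivative 2 * u x * du x) (at x)"
      by (auto intro!: derivative_eq_intros Du)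
  qed (use u0 in auto)
  show ?thesis
  proof (rule DERIV_cong[OF DERIV_add[OF slope corr]])
    define A where "A = arctan (u x * v x)"
    \<comment> \<open>The terms with the factor \<open>v'\<close> cancel.\<close>
    have cancel: "- (dv x * (u x * (v x)\<^sup>2)) / F + dv x / u x - dv x / (u x * F) = 0"
      using u0 F by (simp add: divide_simps) (simp add: F_def algebra_simps power2_eq_square)
    have "(v x * (u x)\<^sup>2 * du x - dv x * (u x * (v x)\<^sup>2)) / F +
      ((dv x * u x - v x * du x) / (u x * u x)
       - (inverse F * (du x * v x + dv x * u x) * (u x)\<^sup>2 - A * (2 * u x * du x)) / ((u x)\<^sup>2 * (u x)\<^sup>2))
      = (- (dv x * (u x * (v x)\<^sup>2)) / F + dv x / u x - dv x / (u x * F))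
        + du x * ((u x)\<^sup>2 * v x / F + 2 * A / u x ^ 3 - v x / (u x)\<^sup>2 - v x / ((u x)\<^sup>2 * F))"
      using u0 F by (simp add: divide_simps) algebra
    also have "\<dots> = du x * \<kappa> (u x) (v x)"
      unfolding cancel by (simp add: \<kappa>_def F_def A_def)
    finally show "(v x * (u x)\<^sup>2 * du x - dv x * (u x * (v x)\<^sup>2)) / F +
      ((dv x * u x - v x * du x) / (u x * u x)
       - (inverse F * (du x * v x + dv x * u x) * (u x)\<^sup>2 - arctan (u x * v x) * (2 * u x * du x))
         / ((u x)\<^sup>2 * (u x)\<^sup>2))
      = du x * \<kappa> (u x) (v x)"
      unfolding A_def .
  qed
qed

lemma angle_at_top: "(angle \<longlongrightarrow> 0) at_top"
proof -
  have "((\<lambda>x. angle_correction (u x) (v x)) \<longlongrightarrow> 0) at_top"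
  proof (rule tendsto_sandwich[where f = "\<lambda>_. 0"])
    show "((\<lambda>x. v 0 / u x) \<longlongrightarrow> 0) at_top"
      by (rule tendsto_divide_0[OF tendsto_const]) (rule filterlim_at_top_imp_at_infinity[OF u_at_top])
    have "angle_correction (u x) (v x) \<le> v 0 / u x" if "0 \<le> x" for x
      using angle_correction_bounds(2)[OF u_pos[of x] v_pos[of x]]
        divide_right_mono[OF v_antimono[OF that], of "u x"] u_pos[of x] by simp
    then show "eventually (\<lambda>x. angle_correction (u x) (v x) \<le> v 0 / u x) at_top"
      using eventually_at_top_linorder by blast
    show "eventually (\<lambda>x. 0 \<le> angle_correction (u x) (v x)) at_top"
      by (intro always_eventually allI angle_correction_bounds(1) u_pos v_pos)
  qed simp
  from tendsto_add[OF tendsto_arctan[OF slope_at_top] this] show ?thesis by simp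
qed

lemma angle_at_bot: "(angle \<longlongrightarrow> - (pi / 2)) at_bot"
proof -
  have "((\<lambda>x. angle_correction (u x) (v x)) \<longlongrightarrow> 0) at_bot"
  proof (rule tendsto_sandwich[where f = "\<lambda>_. 0"])
    show "((\<lambda>x. u x * v x ^ 3 / 3) \<longlongrightarrow> 0) at_bot"
      using tendsto_divide[OF u_v_cubed_at_bot tendsto_const, of 3] by simp
    show "eventually (\<lambda>x. angle_correction (u x) (v x) \<le> u x * v x ^ 3 / 3) at_bot"
      by (intro always_eventually allI angle_correction_bounds(3) u_pos v_pos)
    show "eventually (\<lambda>x. 0 \<le> angle_correction (u x) (v x)) at_bot"
      by (intro always_eventually allI angle_correction_bounds(1) u_pos v_pos)
  qed simp
  moreover have "((\<lambda>x. arctan (dv x / du x)) \<longlongrightarrow> - (pi / 2)) at_bot"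
  proof -
    have "arctan (dv x / du x) = - (pi / 2) - arctan (du x / dv x)" for x
    proof -
      have neg: "du x / dv x < 0" using du_pos[of x] dv_neg[of x] by (rule divide_pos_neg)
      then have "du x / dv x \<noteq> 0" by linarith
      have "arctan (dv x / du x) = arctan (1 / (du x / dv x))" by simp
      also have "\<dots> = sgn (du x / dv x) * pi / 2 - arctan (du x / dv x)"
        by (rule arctan_inverse) fact
      also have "\<dots> = - (pi / 2) - arctan (du x / dv x)"
        unfolding sgn_neg[OF neg] by linarith
      finally show ?thesis .
    qed
    moreover have "((\<lambda>x. - (pi / 2) - arctan (du x / dv x)) \<longlongrightarrow> - (pi / 2)) at_bot"
      using tendsto_diff[OF tendsto_const tendsto_arctan[OF inverse_slope_at_bot], of "- (pi / 2)"]
      by simp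
    ultimately show ?thesis by simp
  qed
  ultimately show ?thesis using tendsto_add by fastforce
qed

lemma phase_curve: "phase_curve (\<lambda>s. v (inv u s)) (\<lambda>s. dv (inv u s) / du (inv u s))"
proof
  let ?A = "corrected_angle (\<lambda>s. v (inv u s)) (\<lambda>s. dv (inv u s) / du (inv u s))"
  have A: "?A s = angle (inv u s)" if "0 < s" for s
    using that by (simp add: corrected_angle_def u_inv)
  fix s :: real assume s: "0 < s"
  show "0 < v (inv u s)" by (rule v_pos)
  show "s * v (inv u s) \<le> 1" using uv_le_1[of "inv u s"] by (simp add: u_inv s)
  show "((\<lambda>s. v (inv u s)) has_real_derivative dv (inv u s) / du (inv u s)) (at s)"
    using DERIV_chain2[OF Dv D_inv_u[OF s]] by (simp add: divide_inverse)
  have "((\<lambda>s. angle (inv u s)) has_real_derivative \<kappa> s (v (inv u s))) (at s)"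
  proof (rule DERIV_cong[OF DERIV_chain2[OF D_angle D_inv_u[OF s]]])
    show "du (inv u s) * \<kappa> (u (inv u s)) (v (inv u s)) * inverse (du (inv u s)) = \<kappa> s (v (inv u s))"
      using du_nonzero[of "inv u s"] by (simp add: u_inv s)
  qed
  then show "(?A has_real_derivative \<kappa> s (v (inv u s))) (at s)"
    by (rule has_field_derivative_transform_within_open[of _ _ _ "{0<..}"]) (use s A in auto)
next
  let ?A = "corrected_angle (\<lambda>s. v (inv u s)) (\<lambda>s. dv (inv u s) / du (inv u s))"
  have A: "?A s = angle (inv u s)" if "0 < s" for s
    using that by (simp add: corrected_angle_def u_inv)
  have "((\<lambda>s. angle (inv u s)) \<longlongrightarrow> - (pi / 2)) (at_right 0)"
    by (rule filterlim_compose[OF angle_at_bot inv_u_at_right_0])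
  moreover have "eventually (\<lambda>s. angle (inv u s) = ?A s) (at_right 0)"
    by (rule eventually_mono[OF eventually_at_right_less[of 0]]) (simp add: A)
  ultimately show "(?A \<longlongrightarrow> - (pi / 2)) (at_right 0)" by (rule Lim_transform_eventually)
  have "((\<lambda>s. angle (inv u s)) \<longlongrightarrow> 0) at_top"
    by (rule filterlim_compose[OF angle_at_top inv_u_at_top])
  moreover have "eventually (\<lambda>s. angle (inv u s) = ?A s) at_top"
    by (rule eventually_mono[OF eventually_gt_at_top[of 0]]) (simp add: A)
  ultimately show "(?A \<longlongrightarrow> 0) at_top" by (rule Lim_transform_eventually)
qed

end

text \<open>The graphs agree, hence so do their slopes, and the conserved quantity then yields equal
  velocities at corresponding points. So the change of parameter from one solution to the other
  has derivative 1.\<close>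

lemma normalised_unique_up_to_translation:
  assumes "normalised_system u1 v1 du1 dv1" "normalised_system u2 v2 du2 dv2"
  obtains t where "\<And>x. u2 x = u1 (x + t)" "\<And>x. v2 x = v1 (x + t)"
proof -
  interpret n1: normalised_system u1 v1 du1 dv1 by fact
  interpret n2: normalised_system u2 v2 du2 dv2 by fact
  interpret c1: phase_curve "\<lambda>s. v1 (inv u1 s)" "\<lambda>s. dv1 (inv u1 s) / du1 (inv u1 s)"
    by (rule n1.phase_curve)
  interpret c2: phase_curve "\<lambda>s. v2 (inv u2 s)" "\<lambda>s. dv2 (inv u2 s) / du2 (inv u2 s)"
    by (rule n2.phase_curve)
  have graph: "v1 (inv u1 s) = v2 (inv u2 s)" if "0 < s" for s
    using phase_curve_le[OF n1.phase_curve n2.phase_curve that]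
      phase_curve_le[OF n2.phase_curve n1.phase_curve that] by simp
  have slope: "dv1 (inv u1 s) / du1 (inv u1 s) = dv2 (inv u2 s) / du2 (inv u2 s)" if "0 < s" for s
  proof (rule DERIV_unique[OF _ c2.Df[OF that]])
    show "((\<lambda>s. v2 (inv u2 s)) has_real_derivative dv1 (inv u1 s) / du1 (inv u1 s)) (at s)"
      by (rule has_field_derivative_transform_within_open[OF c1.Df[OF that], of "{0<..}"])
        (use that graph in auto)
  qed
  define m where "m x = inv u1 (u2 x)" for x
  have u1m: "u1 (m x) = u2 x" for x by (simp add: m_def n1.u_inv n2.u_pos)
  have v1m: "v1 (m x) = v2 x" for x
    using graph[OF n2.u_pos[of x]] by (simp add: m_def n2.inv_u)
  have velocity: "du1 (m x) = du2 x" for x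
  proof -
    define k where "k = dv2 x / du2 x"
    have k1: "dv1 (m x) = k * du1 (m x)"
      using slope[OF n2.u_pos[of x]] n1.du_nonzero[of "m x"]
      by (simp add: k_def m_def n2.inv_u field_simps)
    have k2: "dv2 x = k * du2 x" using n2.du_nonzero[of x] by (simp add: k_def)
    have "(du1 (m x))\<^sup>2 * (1 + k\<^sup>2) = (du2 x)\<^sup>2 * (1 + k\<^sup>2)"
      using n1.energy[of "m x"] n2.energy[of x] unfolding k1 k2 u1m v1m
      by (simp add: algebra_simps power_mult_distrib)
    moreover have "1 + k\<^sup>2 \<noteq> 0" by (metis add_pos_nonneg less_irrefl zero_le_power2 zero_less_one)
    ultimately have "(du1 (m x))\<^sup>2 = (du2 x)\<^sup>2" by simp
    then show ?thesis
      using n1.du_pos[of "m x"] n2.du_pos[of x] by (simp add: power2_eq_iff_nonneg less_imp_le)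
  qed
  have "((\<lambda>x. m x - x) has_real_derivative 0) (at x)" for x
  proof -
    have "(m has_real_derivative inverse (du1 (m x)) * du2 x) (at x)"
      unfolding m_def[abs_def] by (rule DERIV_chain2[OF n1.D_inv_u[OF n2.u_pos] n2.Du])
    then have "(m has_real_derivative 1) (at x)"
      using n2.du_nonzero[of x] by (simp add: velocity)
    from DERIV_diff[OF this DERIV_ident] show ?thesis by simp
  qed
  then have const: "m x - x = m 0 - 0" for x by (rule DERIV_isconst_all[rule_format])
  have "m x = x + m 0" for x using const[of x] by linarith
  with u1m v1m show thesis by (intro that[of "m 0"]) metis+
qed

section \<open>Normalisation by scaling\<close>

lemma normalise_monotone:
  assumes "monotone_system u v du dv"
  obtains l du' dv' where "0 < l" "normalised_system (scaling l u) (scaling l v) du' dv'"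
proof -
  interpret monotone_system u v du dv by fact
  define H where "H = (du 0)\<^sup>2 + (dv 0)\<^sup>2 - (u 0 * v 0)\<^sup>2"
  have H: "0 < H"
    using uv_square_le_du_square[of 0] dv_neg[of 0] zero_less_power2[of "dv 0"] unfolding H_def by linarith
  \<comment> \<open>Scaling by \<open>l\<close> multiplies the conserved quantity by \<open>l\<^sup>4\<close>.\<close>
  define l where "l = 1 / sqrt (sqrt H)"
  have l: "0 < l" using H by (simp add: l_def)
  have l4: "l ^ 4 * H = 1"
  proof -
    have "l ^ 4 = (l\<^sup>2)\<^sup>2" by (simp flip: power_mult)
    also have "\<dots> = 1 / H" using H by (simp add: l_def power_divide)
    finally show ?thesis using H by simp
  qed
  interpret s: entire_system "scaling l u" "scaling l v" "\<lambda>x. l\<^sup>2 * du (l * x)" "\<lambda>x. l\<^sup>2 * dv (l * x)"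
    by (rule scaled[OF l])
  have "normalised_system (scaling l u) (scaling l v) (\<lambda>x. l\<^sup>2 * du (l * x)) (\<lambda>x. l\<^sup>2 * dv (l * x))"
  proof
    fix x
    show "0 < l\<^sup>2 * du (l * x)" using l du_pos by simp
    show "l\<^sup>2 * dv (l * x) < 0" using l dv_neg by (simp add: mult_pos_neg)
    have "(l\<^sup>2 * du (l * x))\<^sup>2 + (l\<^sup>2 * dv (l * x))\<^sup>2 - (scaling l u x * scaling l v x)\<^sup>2
      = l ^ 4 * ((du (l * x))\<^sup>2 + (dv (l * x))\<^sup>2 - (u (l * x) * v (l * x))\<^sup>2)"
      unfolding scaling_def by algebra
    also have "\<dots> = 1" using energy_constant[of "l * x" 0] l4 by (simp add: H_def)
    finally show "(l\<^sup>2 * du (l * x))\<^sup>2 + (l\<^sup>2 * dv (l * x))\<^sup>2 = 1 + (scaling l u x * scaling l v x)\<^sup>2"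
      by simp
  qed
  with l show thesis by (rule that)
qed

lemma monotone_unique:
  assumes "monotone_system u1 v1 du1 dv1" "monotone_system u2 v2 du2 dv2"
  shows "equal_up_to_translation_scaling (u1, v1) (u2, v2)"
proof -
  obtain l1 du1' dv1' where l1: "0 < l1"
    and n1: "normalised_system (scaling l1 u1) (scaling l1 v1) du1' dv1'"
    by (rule normalise_monotone[OF assms(1)])
  obtain l2 du2' dv2' where l2: "0 < l2"
    and n2: "normalised_system (scaling l2 u2) (scaling l2 v2) du2' dv2'"
    by (rule normalise_monotone[OF assms(2)])
  obtain t where t: "\<And>x. scaling l2 u2 x = scaling l1 u1 (x + t)"
      "\<And>x. scaling l2 v2 x = scaling l1 v1 (x + t)"
    using normalised_unique_up_to_translation[OF n1 n2] by metis
  have "f2 = scaling (l1 / l2) (translation (l1 * t) f1)"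
    if "\<And>x. scaling l2 f2 x = scaling l1 f1 (x + t)" for f1 f2
  proof
    fix x
    show "f2 x = scaling (l1 / l2) (translation (l1 * t) f1) x"
      using that[of "x / l2"] l2 by (simp add: scaling_def translation_def field_simps)
  qed
  with t l1 l2 show ?thesis
    unfolding equal_up_to_translation_scaling_def by (metis divide_pos_pos fst_conv snd_conv)
qed

lemma entire_solution_monotone:
  assumes "entire_solution u v"
  obtains du dv where "monotone_system u v du dv \<or> monotone_system v u dv du"
proof -
  obtain du dv where "entire_system u v du dv"
    using assms unfolding entire_solution_def entire_system_def by blast
  then interpret entire_system u v du dv .
  show thesis
    using du_sign_constant
  proof
    assume "\<forall>x. 0 < du x"
    then have "monotone_system u v du dv"
      using opposite_signs by unfold_locales (auto, meson less_asym)
    then show thesis by (blast intro: that)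
  next
    assume neg: "\<forall>x. du x < 0"
    interpret sw: entire_system v u dv du by (rule swapped)
    have "monotone_system v u dv du"
      using opposite_signs neg by unfold_locales (auto, meson less_asym)
    then show thesis by (blast intro: that)
  qed
qed

theorem theorem1p1:
  fixes u1 v1 u2 v2 :: "real \<Rightarrow> real"
  assumes "entire_solution u1 v1"
    and "entire_solution u2 v2"
  shows "equal_up_to_translation_scaling (u1, v1) (u2, v2) \<or>
         equal_up_to_translation_scaling (v1, u1) (u2, v2)"
proof -
  obtain du1 dv1 where m1: "monotone_system u1 v1 du1 dv1 \<or> monotone_system v1 u1 dv1 du1"
    by (rule entire_solution_monotone[OF assms(1)])
  obtain du2 dv2 where m2: "monotone_system u2 v2 du2 dv2 \<or> monotone_system v2 u2 dv2 du2"
    by (rule entire_solution_monotone[OF assms(2)])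
  have swap: "equal_up_to_translation_scaling (b, a) (d, c)"
    if "equal_up_to_translation_scaling (a, b) (c, d)" for a b c d
    using that unfolding equal_up_to_translation_scaling_def by auto
  from m1 m2 show ?thesis by (metis monotone_unique swap)
qed

end
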